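(* Let $\mathbb{E}$ be an effect algebra. (i) For all $D_{\mathbb{E}}$-coalgebras $c:X\to D_{\mathbb{E}}X$ and $d:Y\to D_{\mathbb{E}}Y$ and all $x\in X$, $y\in Y$: if $x\sim_{AM}y$ then $x\sim_k y$. (ii) The implication "$x\sim_k y\Rightarrow x\sim_{AM}y$" holds for all $D_{\mathbb{E}}$-coalgebras $(X,c),(Y,d)$ and all $x\in X$, $y\in Y$ if and only if $\mathbb{E}$ is decomposable.
   Context: An effect algebra is a set $\mathbb{E}$ with $0\in\mathbb{E}$, a partial commutative associative binary operation $+$ with unit $0$ ($a\perp b$ means $a+b$ is defined; associativity: if $b\perp c$ and $a\perp(b+c)$ then $a\perp b$, $(a+b)\perp c$ and $(a+b)+c=a+(b+c)$), and a unary operation $e\mapsto e'$ such that $e'$ is the unique element with $e+e'=1$, where $1=0'$, and $e\perp1$ implies $e=0$. Its order is $a\sqsubseteq b$ iff $a+c=b$ for some $c$. $D_{\mathbb{E}}:\mathbf{Set}\to\mathbf{Set}$ sends $X$ to the set of finitely supported $\Delta:X\to\mathbb{E}$ such that $\sum_{x\in\mathrm{supp}(\Delta)}\Delta(x)$ is defined, and $f:X\to Y$ to $(D_{\mathbb{E}}f)(\Delta)(y)=\sum_{x\in f^{-1}(y)}\Delta(x)$. A $D_{\mathbb{E}}$-coalgebra is a pair $(X,c)$ with $c:X\to D_{\mathbb{E}}X$; a homomorphism $f:(X,c)\to(Y,d)$ is a map with $D_{\mathbb{E}}f\circ c=d\circ f$. Aczel–Mendler bisimilarity: a relation $R\subseteq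 X\times Y$ is an AM-bisimulation between $(X,c)$ and $(Y,d)$ if there is a coalgebra structure $e:R\to D_{\mathbb{E}}R$ making both projections $\pi_1:R\to X$, $\pi_2:R\to Y$ coalgebra homomorphisms; $x\sim_{AM}y$ iff $(x,y)\in R$ for some AM-bisimulation $R$. Kernel bisimilarity: a cocongruence is a cospan $X\xrightarrow{m_1}Z\xleftarrow{m_2}Y$ of maps such that some coalgebra $(Z,e)$ makes $m_1,m_2$ coalgebra homomorphisms; its kernel bisimulation is $\{(x,y):m_1(x)=m_2(y)\}$; kernel bisimilarity $\sim_k$ is the largest kernel bisimulation, i.e. $x\sim_k y$ iff some cocongruence has $m_1(x)=m_2(y)$. $\mathbb{E}$ is decomposable if for all $a,b,c,d\in\mathbb{E}$ with $a\perp b$, $c\perp d$ and $a+b=c+d$ there exist $e_{11},e_{12},e_{21},e_{22}\in\mathbb{E}$ with $a=e_{11}+e_{12}$, $b=e_{21}+e_{22}$, $c=e_{11}+e_{21}$, $d=e_{12}+e_{22}$. *)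

theory Defs
  imports "HOL-Library.FuncSet" "HOL-Library.Infinite_Typeclass"
begin

(* The partial operation is option-valued: a \<oplus> b = None means that a + b is undefined.
   The constant 1 is ocompl 0. *)
class effect_algebra = zero +
  fixes oplus :: "'a \<Rightarrow> 'a \<Rightarrow> 'a option"  (infixl \<open>\<oplus>\<close> 65)
    and ocompl :: "'a \<Rightarrow> 'a"
  assumes oplus_commute: "a \<oplus> b = b \<oplus> a"
    and oplus_zero: "a \<oplus> 0 = Some a"
    and oplus_assoc:
      "b \<oplus> c = Some u \<Longrightarrow> a \<oplus> u = Some v \<Longrightarrow> \<exists>w. a \<oplus> b = Some w \<and> w \<oplus> c = Some v"
    and oplus_ocompl: "e \<oplus> ocompl e = Some (ocompl 0)"
    and ocompl_unique: "e \<oplus> f = Some (ocompl 0) \<Longrightarrow> f = ocompl e"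
    and perp_one_zero: "e \<oplus> ocompl 0 \<noteq> None \<Longrightarrow> e = 0"

definition decomposable :: "'e::effect_algebra itself \<Rightarrow> bool" where
  "decomposable _ \<longleftrightarrow>
     (\<forall>a b c d :: 'e. a \<oplus> b \<noteq> None \<and> c \<oplus> d \<noteq> None \<and> a \<oplus> b = c \<oplus> d \<longrightarrow>
        (\<exists>e11 e12 e21 e22.
           Some a = e11 \<oplus> e12 \<and> Some b = e21 \<oplus> e22 \<and>
           Some c = e11 \<oplus> e21 \<and> Some d = e12 \<oplus> e22))"

(* Strict extension of \<oplus> to options. It is a total commutative monoid, so finite partial sums
   are its big operator; a sum is undefined iff its value is None. *)
definition opt_plus :: "'e::effect_algebra option \<Rightarrow> 'e option \<Rightarrow> 'e option" where
  "opt_plus s t = Option.bind s (\<lambda>a. Option.bind t (\<lambda>b. a \<oplus> b))"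

global_interpretation opt_sum: comm_monoid_set opt_plus "Some (0 :: 'e::effect_algebra)"
  defines opt_sum = opt_sum.F
proof
  fix s t r :: "'e option"
  show comm: "opt_plus s t = opt_plus t s" for s t :: "'e option"
    by (cases s; cases t) (auto simp: opt_plus_def oplus_commute)
  show "opt_plus s (Some 0) = s"
    by (cases s) (auto simp: opt_plus_def oplus_zero)
  have right: "opt_plus (opt_plus s t) r = Some v" if "opt_plus s (opt_plus t r) = Some v"
    for s t r :: "'e option" and v
    using that oplus_assoc
    by (fastforce simp: opt_plus_def bind_eq_Some_conv)
  have left: "opt_plus s (opt_plus t r) = Some v" if "opt_plus (opt_plus s t) r = Some v" for v
    using right[of r t s v] that by (simp add: comm)
  show "opt_plus (opt_plus s t) r = opt_plus s (opt_plus t r)"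
  proof (cases "opt_plus s (opt_plus t r)")
    case None
    then show ?thesis using left by (cases "opt_plus (opt_plus s t) r") auto
  next
    case (Some v)
    then show ?thesis using right by simp
  qed
qed

definition esum :: "('x \<Rightarrow> 'e::effect_algebra) \<Rightarrow> 'x set \<Rightarrow> 'e option" where
  "esum \<Delta> A = opt_sum (\<lambda>x. Some (\<Delta> x)) A"

definition supp :: "('x \<Rightarrow> 'e::effect_algebra) \<Rightarrow> 'x set" where
  "supp \<Delta> = {x. \<Delta> x \<noteq> 0}"

(* Carriers are sets X :: 'x set rather than whole types, so that statements can quantify over all
   coalgebras. Such a quantifier has to range over an infinite type 'x to be meaningful: any set
   embeds into some infinite type, whereas a one-element type, say, has too few subsets.
   A map X \<rightarrow> E is represented by its extension by 0. *)
definition D_obj :: "'x set \<Rightarrow> ('x \<Rightarrow> 'e::effect_algebra) set" where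
  "D_obj X = {\<Delta>. supp \<Delta> \<subseteq> X \<and> finite (supp \<Delta>) \<and> esum \<Delta> (supp \<Delta>) \<noteq> None}"

(* The sum over a fibre is the sum over its finitely many elements of nonzero value;
   by D_map_eq below it is defined. *)
definition D_map :: "('x \<Rightarrow> 'y) \<Rightarrow> ('x \<Rightarrow> 'e::effect_algebra) \<Rightarrow> 'y \<Rightarrow> 'e" where
  "D_map f \<Delta> = (\<lambda>y. the (esum \<Delta> {x \<in> supp \<Delta>. f x = y}))"

definition coalgebra :: "'x set \<Rightarrow> ('x \<Rightarrow> 'x \<Rightarrow> 'e::effect_algebra) \<Rightarrow> bool" where
  "coalgebra X c \<longleftrightarrow> c \<in> X \<rightarrow> D_obj X"

definition coalgebra_hom ::
  "'x set \<Rightarrow> ('x \<Rightarrow> 'x \<Rightarrow> 'e::effect_algebra) \<Rightarrow> 'y set \<Rightarrow> ('y \<Rightarrow> 'y \<Rightarrow> 'e) \<Rightarrow> ('x \<Rightarrow> 'y) \<Rightarrow> bool" where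
  "coalgebra_hom X c Y d f \<longleftrightarrow> f \<in> X \<rightarrow> Y \<and> (\<forall>x\<in>X. D_map f (c x) = d (f x))"

definition AM_bisimulation ::
  "'x set \<Rightarrow> ('x \<Rightarrow> 'x \<Rightarrow> 'e::effect_algebra) \<Rightarrow> 'y set \<Rightarrow> ('y \<Rightarrow> 'y \<Rightarrow> 'e) \<Rightarrow> ('x \<times> 'y) set \<Rightarrow> bool" where
  "AM_bisimulation X c Y d R \<longleftrightarrow>
     R \<subseteq> X \<times> Y \<and>
     (\<exists>e. coalgebra R e \<and> coalgebra_hom R e X c fst \<and> coalgebra_hom R e Y d snd)"

definition AM_bisimilar ::
  "'x set \<Rightarrow> ('x \<Rightarrow> 'x \<Rightarrow> 'e::effect_algebra) \<Rightarrow> 'y set \<Rightarrow> ('y \<Rightarrow> 'y \<Rightarrow> 'e) \<Rightarrow> 'x \<Rightarrow> 'y \<Rightarrow> bool" where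
  "AM_bisimilar X c Y d x y \<longleftrightarrow> (\<exists>R. AM_bisimulation X c Y d R \<and> (x, y) \<in> R)"

definition cocongruence ::
  "'x set \<Rightarrow> ('x \<Rightarrow> 'x \<Rightarrow> 'e::effect_algebra) \<Rightarrow> 'y set \<Rightarrow> ('y \<Rightarrow> 'y \<Rightarrow> 'e) \<Rightarrow>
   'z set \<Rightarrow> ('x \<Rightarrow> 'z) \<Rightarrow> ('y \<Rightarrow> 'z) \<Rightarrow> bool" where
  "cocongruence X c Y d Z m1 m2 \<longleftrightarrow>
     (\<exists>e. coalgebra Z e \<and> coalgebra_hom X c Z e m1 \<and> coalgebra_hom Y d Z e m2)"

definition kernel_bisimulation ::
  "'x set \<Rightarrow> 'y set \<Rightarrow> ('x \<Rightarrow> 'z) \<Rightarrow> ('y \<Rightarrow> 'z) \<Rightarrow> ('x \<times> 'y) set" where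
  "kernel_bisimulation X Y m1 m2 = {(x, y) \<in> X \<times> Y. m1 x = m2 y}"

(* The definition cannot quantify over the type carrying Z. The type 'x + 'y has room for a copy of
   the union of the images of m1 and m2, and kernel_bisimilarI below shows that cocongruences
   carried by any other type relate no further pairs. *)
definition kernel_bisimilar ::
  "'x set \<Rightarrow> ('x \<Rightarrow> 'x \<Rightarrow> 'e::effect_algebra) \<Rightarrow> 'y set \<Rightarrow> ('y \<Rightarrow> 'y \<Rightarrow> 'e) \<Rightarrow> 'x \<Rightarrow> 'y \<Rightarrow> bool" where
  "kernel_bisimilar X c Y d x y \<longleftrightarrow>
     (\<exists>(Z :: ('x + 'y) set) m1 m2.
        cocongruence X c Y d Z m1 m2 \<and> (x, y) \<in> kernel_bisimulation X Y m1 m2)"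

lemma opt_plus_neq_None: "opt_plus s t \<noteq> None \<Longrightarrow> s \<noteq> None \<and> t \<noteq> None"
  by (cases s; cases t) (simp_all add: opt_plus_def)

lemma esum_subset_defined:
  assumes "finite A" "B \<subseteq> A" "esum \<Delta> A \<noteq> None"
  shows "esum \<Delta> B \<noteq> None"
  using assms opt_sum.subset_diff[of B A "\<lambda>x. Some (\<Delta> x)"] opt_plus_neq_None
  unfolding esum_def by metis

lemma D_map_eq:
  assumes "\<Delta> \<in> D_obj X"
  shows "esum \<Delta> {x \<in> supp \<Delta>. f x = y} = Some (D_map f \<Delta> y)"
  using esum_subset_defined[of "supp \<Delta>" "{x \<in> supp \<Delta>. f x = y}" \<Delta>] assms
  by (auto simp: D_map_def D_obj_def)

lemma supp_D_map: "supp (D_map f \<Delta>) \<subseteq> f ` supp \<Delta>"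
proof
  fix y assume y: "y \<in> supp (D_map f \<Delta>)"
  have "{x \<in> supp \<Delta>. f x = y} \<noteq> {}"
  proof
    assume "{x \<in> supp \<Delta>. f x = y} = {}"
    then have "D_map f \<Delta> y = the (esum \<Delta> {})"
      by (simp only: D_map_def)
    then have "D_map f \<Delta> y = 0"
      by (simp add: esum_def)
    with y show False by (simp add: supp_def)
  qed
  then show "y \<in> f ` supp \<Delta>" by blast
qed

lemma esum_D_map:
  assumes \<Delta>: "\<Delta> \<in> D_obj X"
  shows "esum (D_map f \<Delta>) {y \<in> supp (D_map f \<Delta>). P y} = esum \<Delta> {x \<in> supp \<Delta>. P (f x)}"
proof -
  let ?S = "{x \<in> supp \<Delta>. P (f x)}" and ?T = "{y \<in> f ` supp \<Delta>. P y}"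
  let ?h = "\<lambda>x. Some (\<Delta> x)"
  have fin: "finite (supp \<Delta>)" using \<Delta> by (simp add: D_obj_def)
  have "esum (D_map f \<Delta>) {y \<in> supp (D_map f \<Delta>). P y} = esum (D_map f \<Delta>) ?T"
    unfolding esum_def using fin supp_D_map[of f \<Delta>]
    by (intro opt_sum.mono_neutral_left) (auto simp: supp_def)
  also have "\<dots> = opt_sum (\<lambda>y. opt_sum ?h {x. x \<in> ?S \<and> f x = y}) ?T"
    unfolding esum_def
  proof (rule opt_sum.cong)
    fix y assume "y \<in> ?T"
    then have "{x. x \<in> ?S \<and> f x = y} = {x \<in> supp \<Delta>. f x = y}" by auto
    then show "Some (D_map f \<Delta> y) = opt_sum ?h {x. x \<in> ?S \<and> f x = y}"
      using D_map_eq[OF \<Delta>, of f y] by (simp add: esum_def)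
  qed simp
  also have "\<dots> = opt_sum ?h ?S"
    using fin by (intro opt_sum.group) auto
  finally show ?thesis by (simp add: esum_def)
qed

lemma D_map_in_D_obj:
  assumes \<Delta>: "\<Delta> \<in> D_obj X" and f: "f \<in> X \<rightarrow> Y"
  shows "D_map f \<Delta> \<in> D_obj Y"
proof -
  have "esum (D_map f \<Delta>) (supp (D_map f \<Delta>)) = esum \<Delta> (supp \<Delta>)"
    using esum_D_map[OF \<Delta>, of f "\<lambda>_. True"] by simp
  moreover have "supp (D_map f \<Delta>) \<subseteq> Y"
    using supp_D_map[of f \<Delta>] \<Delta> f by (auto simp: D_obj_def)
  moreover have "finite (supp (D_map f \<Delta>))"
    using supp_D_map[of f \<Delta>] \<Delta> by (auto simp: D_obj_def intro: finite_subset)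
  ultimately show ?thesis using \<Delta> by (simp add: D_obj_def)
qed

lemma D_map_comp: "\<Delta> \<in> D_obj X \<Longrightarrow> D_map g (D_map f \<Delta>) = D_map (g \<circ> f) \<Delta>"
  by (rule ext) (simp add: D_map_def[of g] D_map_def[of "g \<circ> f"] esum_D_map)

lemma kernel_bisimilarI:
  fixes X :: "'x set" and c :: "'x \<Rightarrow> 'x \<Rightarrow> 'e::effect_algebra"
    and Y :: "'y set" and d :: "'y \<Rightarrow> 'y \<Rightarrow> 'e"
    and Z :: "'z set"
  assumes X: "coalgebra X c" and Y: "coalgebra Y d"
    and cc: "cocongruence X c Y d Z m1 m2"
    and xy: "(x, y) \<in> kernel_bisimulation X Y m1 m2"
  shows "kernel_bisimilar X c Y d x y"
proof -
  obtain e where h1: "coalgebra_hom X c Z e m1" and h2: "coalgebra_hom Y d Z e m2"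
    using cc by (auto simp: cocongruence_def)
  define W where "W = m1 ` X \<union> m2 ` Y"
  define g :: "'z \<Rightarrow> 'x + 'y" where
    "g z = (if z \<in> m1 ` X then Inl (inv_into X m1 z) else Inr (inv_into Y m2 z))" for z
  have g: "inj_on g W"
    by (rule inj_onI)
      (auto simp: g_def W_def split: if_splits dest: inv_into_injective)
  define e' where "e' w = D_map g (e (inv_into W g w))" for w
  have e1: "D_map (g \<circ> m1) (c u) = e' (g (m1 u))" if "u \<in> X" for u
  proof -
    have "inv_into W g (g (m1 u)) = m1 u"
      using g that by (auto simp: W_def)
    moreover have "c u \<in> D_obj X"
      using that X by (auto simp: coalgebra_def)
    moreover have "D_map m1 (c u) = e (m1 u)"
      using that h1 by (simp add: coalgebra_hom_def)
    ultimately show ?thesis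
      using D_map_comp[of "c u" X g m1] by (simp add: e'_def)
  qed
  have e2: "D_map (g \<circ> m2) (d v) = e' (g (m2 v))" if "v \<in> Y" for v
  proof -
    have "inv_into W g (g (m2 v)) = m2 v"
      using g that by (auto simp: W_def)
    moreover have "d v \<in> D_obj Y"
      using that Y by (auto simp: coalgebra_def)
    moreover have "D_map m2 (d v) = e (m2 v)"
      using that h2 by (simp add: coalgebra_hom_def)
    ultimately show ?thesis
      using D_map_comp[of "d v" Y g m2] by (simp add: e'_def)
  qed
  have "e' w \<in> D_obj (g ` W)" if "w \<in> g ` W" for w
  proof -
    from that consider u where "u \<in> X" "w = g (m1 u)" | v where "v \<in> Y" "w = g (m2 v)"
      by (auto simp: W_def)
    then show ?thesis
    proof cases
      case 1
      then have "c u \<in> D_obj X" using X by (auto simp: coalgebra_def)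
      moreover have "g \<circ> m1 \<in> X \<rightarrow> g ` W" by (auto simp: W_def)
      ultimately show ?thesis using e1[OF 1(1)] 1(2) D_map_in_D_obj by metis
    next
      case 2
      then have "d v \<in> D_obj Y" using Y by (auto simp: coalgebra_def)
      moreover have "g \<circ> m2 \<in> Y \<rightarrow> g ` W" by (auto simp: W_def)
      ultimately show ?thesis using e2[OF 2(1)] 2(2) D_map_in_D_obj by metis
    qed
  qed
  then have "cocongruence X c Y d (g ` W) (g \<circ> m1) (g \<circ> m2)"
    unfolding cocongruence_def coalgebra_hom_def coalgebra_def
    using e1 e2 by (intro exI[of _ e']) (auto simp: W_def)
  moreover have "(x, y) \<in> kernel_bisimulation X Y (g \<circ> m1) (g \<circ> m2)"
    using xy by (auto simp: kernel_bisimulation_def)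
  ultimately show ?thesis
    unfolding kernel_bisimilar_def by blast
qed

end

theory Submission
  imports Defs
begin

(* For (i), the pushout of the two projections of an AM-bisimulation carries a coalgebra structure.
   For (ii), a pair related by a cocongruence has transition distributions with equal total weight
   on corresponding fibres; a coalgebra structure on the kernel amounts to writing the two weight
   families on each fibre as the row and column sums of a matrix. Decomposability is the 2x2 case of
   this refinement property, and the general finite case follows from it by induction. Conversely,
   the 2x2 case is recovered from two-element coalgebras with constant structure maps. *)

section \<open>Finite sums and positivity\<close>

lemma esum_empty [simp]: "esum \<Delta> {} = Some 0"
  by (simp add: esum_def)

lemma esum_insert:
  assumes "finite A" "a \<notin> A"
  shows "esum \<Delta> (insert a A) = opt_plus (Some (\<Delta> a)) (esum \<Delta> A)"
  using assms by (simp add: esum_def)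

lemma esum_singleton [simp]: "esum \<Delta> {a} = Some (\<Delta> a)"
  using esum_insert[of "{}" a \<Delta>] by (simp add: opt_plus_def oplus_zero)

lemma esum_pair:
  assumes "a \<noteq> b"
  shows "esum \<Delta> {a, b} = \<Delta> a \<oplus> \<Delta> b"
  using assms by (simp add: esum_insert opt_plus_def)

lemma esum_mono_neutral:
  assumes "finite B" "A \<subseteq> B" "\<And>x. x \<in> B - A \<Longrightarrow> \<Delta> x = 0"
  shows "esum \<Delta> A = esum \<Delta> B"
  unfolding esum_def using assms by (intro opt_sum.mono_neutral_left) auto

lemma esum_reindex:
  assumes "inj_on h A"
  shows "esum \<Delta> (h ` A) = esum (\<Delta> \<circ> h) A"
  using opt_sum.reindex[OF assms, of "\<lambda>x. Some (\<Delta> x)"] by (simp add: esum_def comp_def)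

lemma esum_cong:
  assumes "\<And>x. x \<in> A \<Longrightarrow> \<Delta> x = \<Gamma> x"
  shows "esum \<Delta> A = esum \<Gamma> A"
  unfolding esum_def using assms by (intro opt_sum.cong) auto

text \<open>The top element \<open>ocompl 0\<close> is summable with 0 = a + b, so associativity
  makes it summable with \<open>a\<close> alone, and this forces \<open>a\<close> to be 0. Thus
  effect algebras are positive.\<close>

lemma oplus_eq_zeroD:
  fixes a b :: "'e::effect_algebra"
  assumes "a \<oplus> b = Some 0"
  shows "a = 0"
proof -
  have "ocompl 0 \<oplus> (0 :: 'e) = Some (ocompl 0)"
    by (rule oplus_zero)
  from oplus_assoc[OF assms this] show ?thesis
    using perp_one_zero[of a] oplus_commute[of a "ocompl 0"] by auto
qed

lemma esum_eq_zeroD: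
  assumes "finite A" "esum \<Delta> A = Some 0" "a \<in> A"
  shows "\<Delta> a = 0"
proof -
  have "esum \<Delta> (insert a (A - {a})) = Some 0"
    using assms by (simp add: insert_absorb)
  then have "opt_plus (Some (\<Delta> a)) (esum \<Delta> (A - {a})) = Some 0"
    using assms(1) by (simp del: insert_Diff_single add: esum_insert)
  then show ?thesis
    by (auto simp: opt_plus_def bind_eq_Some_conv dest: oplus_eq_zeroD)
qed

section \<open>Common refinement of two equal finite sums\<close>

text \<open>The two-row case of the matrix, with rows \<open>h\<close> and \<open>k\<close>. The 2x2
  property is applied to \<open>g b\<close> against the sum \<open>u\<close> of the other columns:
  \<open>e11\<close> and \<open>e21\<close> fill column \<open>b\<close>, while \<open>e12\<close>
  and \<open>e22\<close> are the row totals left for the induction hypothesis.\<close>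

lemma decomposable_split:
  fixes g :: "'b \<Rightarrow> 'e::effect_algebra"
  assumes dec: "decomposable TYPE('e)" and "finite B" and "s \<oplus> t = esum g B" and "s \<oplus> t \<noteq> None"
  shows "\<exists>h k. esum h B = Some s \<and> esum k B = Some t \<and> (\<forall>b\<in>B. h b \<oplus> k b = Some (g b))"
  using assms(2-)
proof (induction B arbitrary: s t rule: finite_induct)
  case empty
  then have "s = 0" "t = 0"
    using oplus_eq_zeroD[of s t] oplus_eq_zeroD[of t s] by (auto simp: oplus_commute)
  then show ?case by simp
next
  case (insert b B)
  obtain u where u: "esum g B = Some u"
    using insert by (cases "esum g B") (auto simp: esum_insert opt_plus_def)
  then have "s \<oplus> t = g b \<oplus> u"
    using insert by (simp add: esum_insert opt_plus_def)
  with dec insert.prems(2) obtain e11 e12 e21 e22 where e: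
    "e11 \<oplus> e12 = Some s" "e21 \<oplus> e22 = Some t" "e11 \<oplus> e21 = Some (g b)" "e12 \<oplus> e22 = Some u"
    unfolding decomposable_def by metis
  then have "e12 \<oplus> e22 = esum g B" "e12 \<oplus> e22 \<noteq> None"
    using u by simp_all
  from insert.IH[OF this] obtain h k where hk:
    "esum h B = Some e12" "esum k B = Some e22" "\<forall>b\<in>B. h b \<oplus> k b = Some (g b)"
    by auto
  define h' where "h' = h(b := e11)"
  define k' where "k' = k(b := e21)"
  have "esum h' B = esum h B" "esum k' B = esum k B"
    using insert.hyps by (auto simp: h'_def k'_def intro!: esum_cong)
  then have "esum h' (insert b B) = Some s" "esum k' (insert b B) = Some t"
    using e hk insert.hyps by (simp_all add: esum_insert opt_plus_def h'_def k'_def)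
  moreover have "\<forall>b'\<in>insert b B. h' b' \<oplus> k' b' = Some (g b')"
    using e hk insert.hyps by (simp add: h'_def k'_def)
  ultimately show ?case by blast
qed

text \<open>Rows are peeled off one at a time: the two-row case, with totals \<open>f a\<close> and
  the sum \<open>t\<close> of the other rows, yields the row \<open>h\<close> of \<open>a\<close>
  and the column totals \<open>k\<close> left for the other rows. The target \<open>g\<close>
  therefore varies in the induction.\<close>

lemma decomposable_matrix:
  fixes f :: "'a \<Rightarrow> 'e::effect_algebra" and g :: "'b \<Rightarrow> 'e"
  assumes dec: "decomposable TYPE('e)" and "finite A" and B: "finite B"
    and "esum f A = esum g B" and "esum g B \<noteq> None"
  shows "\<exists>M. (\<forall>a\<in>A. esum (M a) B = Some (f a)) \<and> (\<forall>b\<in>B. esum (\<lambda>a. M a b) A = Some (g b))"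
  using assms(2,4,5)
proof (induction A arbitrary: g rule: finite_induct)
  case empty
  \<comment> \<open>Without rows every column sum is 0, and positivity shows that each
    \<open>g b\<close> is 0 as well.\<close>
  then show ?case
    using esum_eq_zeroD[OF B, of g] by simp
next
  case (insert a A)
  obtain t where t: "esum f A = Some t"
    using insert by (cases "esum f A") (auto simp: esum_insert opt_plus_def)
  have "f a \<oplus> t = esum g B"
    using insert t by (simp add: esum_insert opt_plus_def)
  from decomposable_split[OF dec B this] insert.prems obtain h k where hk:
    "esum h B = Some (f a)" "esum k B = Some t" "\<And>b. b \<in> B \<Longrightarrow> h b \<oplus> k b = Some (g b)"
    using \<open>f a \<oplus> t = esum g B\<close> by auto
  from insert.IH[of k] hk t obtain M where M:
    "\<And>a. a \<in> A \<Longrightarrow> esum (M a) B = Some (f a)" "\<And>b. b \<in> B \<Longrightarrow> esum (\<lambda>a. M a b) A = Some (k b)"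
    by auto
  define M' where "M' = M(a := h)"
  have "esum (\<lambda>a. M' a b) A = esum (\<lambda>a. M a b) A" for b
    using insert.hyps by (intro esum_cong) (auto simp: M'_def)
  then have "esum (\<lambda>a. M' a b) (insert a A) = Some (g b)" if "b \<in> B" for b
    using that hk M insert.hyps by (simp add: esum_insert opt_plus_def M'_def)
  moreover have "esum (M' a') B = Some (f a')" if "a' \<in> insert a A" for a'
    using that hk M insert.hyps by (auto simp: M'_def)
  ultimately show ?case by blast
qed

section \<open>Couplings, and from kernel to AM bisimilarity\<close>

text \<open>Points of \<open>S\<close> outside the support weigh 0, so fibre sums may be taken over
  a finite superset that is easier to describe than the support.\<close>

lemma D_map_eqI:
  assumes fin: "finite S" and sub: "supp \<Delta> \<subseteq> S"
    and fibre: "\<And>u. esum \<Delta> {p \<in> S. f p = u} = Some (\<phi> u)"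
  shows "D_map f \<Delta> = \<phi>"
proof
  fix u
  have "esum \<Delta> {p \<in> supp \<Delta>. f p = u} = esum \<Delta> {p \<in> S. f p = u}"
    using fin sub by (intro esum_mono_neutral) (auto simp: supp_def)
  then show "D_map f \<Delta> u = \<phi> u"
    by (simp add: D_map_def fibre)
qed

lemma esum_fibres:
  assumes fin: "finite S" and fibre: "\<And>u. u \<in> f ` S \<Longrightarrow> esum \<Delta> {p \<in> S. f p = u} = Some (\<phi> u)"
  shows "esum \<Delta> S = esum \<phi> (f ` S)"
proof -
  have "esum \<Delta> S = opt_sum (\<lambda>u. opt_sum (\<lambda>p. Some (\<Delta> p)) {p. p \<in> S \<and> f p = u}) (f ` S)"
    unfolding esum_def using fin by (intro opt_sum.group[symmetric]) auto
  also have "\<dots> = esum \<phi> (f ` S)"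
    unfolding esum_def using fibre by (intro opt_sum.cong) (auto simp: esum_def)
  finally show ?thesis .
qed

lemma D_map_cong:
  assumes "\<Delta> \<in> D_obj X" "\<And>x. x \<in> X \<Longrightarrow> f x = g x"
  shows "D_map f \<Delta> = D_map g \<Delta>"
proof
  fix y
  have "{x \<in> supp \<Delta>. f x = y} = {x \<in> supp \<Delta>. g x = y}"
    using assms by (auto simp: D_obj_def)
  then show "D_map f \<Delta> y = D_map g \<Delta> y"
    by (simp only: D_map_def)
qed

text \<open>Equal images mean that over each \<open>z\<close> the fibres of \<open>m1\<close> and
  \<open>m2\<close> carry the same defined total weight. Each fibre pair then has a matrix, and
  pasting these matrices together gives a joint distribution with the prescribed marginals.\<close>

lemma decomposable_coupling:
  fixes \<Gamma> :: "'x \<Rightarrow> 'e::effect_algebra" and \<Theta> :: "'y \<Rightarrow> 'e"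
  assumes dec: "decomposable TYPE('e)" and \<Gamma>: "\<Gamma> \<in> D_obj X" and \<Theta>: "\<Theta> \<in> D_obj Y"
    and eq: "D_map m1 \<Gamma> = D_map m2 \<Theta>"
  shows "\<exists>\<Delta> \<in> D_obj (kernel_bisimulation X Y m1 m2). D_map fst \<Delta> = \<Gamma> \<and> D_map snd \<Delta> = \<Theta>"
proof -
  define A where "A z = {u \<in> supp \<Gamma>. m1 u = z}" for z
  define B where "B z = {v \<in> supp \<Theta>. m2 v = z}" for z
  have fin: "finite (supp \<Gamma>)" "finite (supp \<Theta>)"
    using \<Gamma> \<Theta> by (auto simp: D_obj_def)
  have "\<forall>z. \<exists>M. (\<forall>a\<in>A z. esum (M a) (B z) = Some (\<Gamma> a)) \<and>
                (\<forall>b\<in>B z. esum (\<lambda>a. M a b) (A z) = Some (\<Theta> b))"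
  proof (intro allI decomposable_matrix[OF dec])
    fix z
    show "esum \<Gamma> (A z) = esum \<Theta> (B z)" "esum \<Theta> (B z) \<noteq> None"
      using D_map_eq[OF \<Gamma>, of m1 z] D_map_eq[OF \<Theta>, of m2 z] eq by (simp_all add: A_def B_def)
  qed (use fin in \<open>auto simp: A_def B_def\<close>)
  from choice[OF this] obtain M where
    M1: "\<And>z a. a \<in> A z \<Longrightarrow> esum (M z a) (B z) = Some (\<Gamma> a)" and
    M2: "\<And>z b. b \<in> B z \<Longrightarrow> esum (\<lambda>a. M z a b) (A z) = Some (\<Theta> b)"
    by auto
  define S where "S = {(u, v) \<in> supp \<Gamma> \<times> supp \<Theta>. m1 u = m2 v}"
  \<comment> \<open>On \<open>S\<close> the index \<open>m1 (fst p)\<close> equals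
    \<open>m2 (snd p)\<close>, so the row and the column computations below read the same
    matrix.\<close>
  define \<Delta> where "\<Delta> p = (if p \<in> S then M (m1 (fst p)) (fst p) (snd p) else 0)" for p
  have S: "finite S" "supp \<Delta> \<subseteq> S"
    using finite_subset[of S "supp \<Gamma> \<times> supp \<Theta>"] fin by (auto simp: S_def \<Delta>_def supp_def)
  have fst: "esum \<Delta> {p \<in> S. fst p = u} = Some (\<Gamma> u)" for u
  proof (cases "u \<in> supp \<Gamma>")
    case True
    have "{p \<in> S. fst p = u} = Pair u ` B (m1 u)"
      using True by (auto simp: S_def B_def)
    then have "esum \<Delta> {p \<in> S. fst p = u} = esum (\<Delta> \<circ> Pair u) (B (m1 u))"
      by (simp add: esum_reindex inj_on_def)
    also have "\<dots> = esum (M (m1 u) u) (B (m1 u))"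
      using True by (intro esum_cong) (auto simp: \<Delta>_def S_def B_def)
    finally show ?thesis
      using True M1 by (simp add: A_def)
  next
    case False
    then have "{p \<in> S. fst p = u} = {}" "\<Gamma> u = 0"
      by (auto simp: S_def supp_def)
    then show ?thesis by (simp only: esum_empty)
  qed
  have snd: "esum \<Delta> {p \<in> S. snd p = v} = Some (\<Theta> v)" for v
  proof (cases "v \<in> supp \<Theta>")
    case True
    have "{p \<in> S. snd p = v} = (\<lambda>u. (u, v)) ` A (m2 v)"
      using True by (auto simp: S_def A_def)
    then have "esum \<Delta> {p \<in> S. snd p = v} = esum (\<Delta> \<circ> (\<lambda>u. (u, v))) (A (m2 v))"
      by (simp add: esum_reindex inj_on_def)
    also have "\<dots> = esum (\<lambda>u. M (m2 v) u v) (A (m2 v))"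
      using True by (intro esum_cong) (auto simp: \<Delta>_def S_def A_def)
    finally show ?thesis
      using True M2 by (simp add: B_def)
  next
    case False
    then have "{p \<in> S. snd p = v} = {}" "\<Theta> v = 0"
      by (auto simp: S_def supp_def)
    then show ?thesis by (simp only: esum_empty)
  qed
  \<comment> \<open>Definedness of the joint sum: grouped by first coordinates it is a subsum of the
    defined total of \<open>\<Gamma>\<close>.\<close>
  have "esum \<Delta> S = esum \<Gamma> (fst ` S)"
    using S(1) fst by (intro esum_fibres) auto
  moreover have "fst ` S \<subseteq> supp \<Gamma>"
    by (auto simp: S_def)
  then have "esum \<Gamma> (fst ` S) \<noteq> None"
    using \<Gamma> by (intro esum_subset_defined[OF fin(1), of "fst ` S" \<Gamma>]) (simp_all add: D_obj_def)
  ultimately have "esum \<Delta> (supp \<Delta>) \<noteq> None"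
    using S esum_subset_defined[of S "supp \<Delta>" \<Delta>] by simp
  moreover have "S \<subseteq> kernel_bisimulation X Y m1 m2"
    using \<Gamma> \<Theta> by (auto simp: S_def kernel_bisimulation_def D_obj_def)
  ultimately have "\<Delta> \<in> D_obj (kernel_bisimulation X Y m1 m2)"
    using S by (auto simp: D_obj_def intro: finite_subset)
  then show ?thesis
    using D_map_eqI[OF S fst] D_map_eqI[OF S snd] by blast
qed

text \<open>The kernel of the cocongruence is itself an AM-bisimulation: at each related pair the
  two successor distributions have the same image in \<open>Z\<close>, and a choice of one coupling
  per pair is the required structure.\<close>

lemma AM_bisimilar_if_kernel_bisimilar:
  fixes c :: "'x \<Rightarrow> 'x \<Rightarrow> 'e::effect_algebra" and d :: "'y \<Rightarrow> 'y \<Rightarrow> 'e"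
  assumes dec: "decomposable TYPE('e)" and X: "coalgebra X c" and Y: "coalgebra Y d"
    and "kernel_bisimilar X c Y d x y"
  shows "AM_bisimilar X c Y d x y"
proof -
  obtain Z :: "('x + 'y) set" and m1 m2 where
    cc: "cocongruence X c Y d Z m1 m2" and xy: "(x, y) \<in> kernel_bisimulation X Y m1 m2"
    using assms(4) by (auto simp: kernel_bisimilar_def)
  let ?R = "kernel_bisimulation X Y m1 m2"
  have "\<forall>p\<in>?R. \<exists>\<Delta>. \<Delta> \<in> D_obj ?R \<and> D_map fst \<Delta> = c (fst p) \<and> D_map snd \<Delta> = d (snd p)"
  proof (intro ballI decomposable_coupling[OF dec, unfolded Bex_def])
    fix p assume p: "p \<in> ?R"
    show "c (fst p) \<in> D_obj X" "d (snd p) \<in> D_obj Y"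
      using p X Y by (auto simp: kernel_bisimulation_def coalgebra_def)
    show "D_map m1 (c (fst p)) = D_map m2 (d (snd p))"
      using p cc by (auto simp: kernel_bisimulation_def cocongruence_def coalgebra_hom_def)
  qed
  from bchoice[OF this] obtain e where
    "\<And>p. p \<in> ?R \<Longrightarrow> e p \<in> D_obj ?R \<and> D_map fst (e p) = c (fst p) \<and> D_map snd (e p) = d (snd p)"
    by auto
  then have "AM_bisimulation X c Y d ?R"
    unfolding AM_bisimulation_def coalgebra_hom_def coalgebra_def
    by (intro conjI exI[of _ e]) (auto simp: kernel_bisimulation_def)
  with xy show ?thesis
    by (auto simp: AM_bisimilar_def)
qed

section \<open>From AM to kernel bisimilarity\<close>

lemma kernel_bisimilar_if_AM_bisimilar:
  fixes c :: "'x \<Rightarrow> 'x \<Rightarrow> 'e::effect_algebra" and d :: "'y \<Rightarrow> 'y \<Rightarrow> 'e"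
  assumes X: "coalgebra X c" and Y: "coalgebra Y d" and "AM_bisimilar X c Y d x y"
  shows "kernel_bisimilar X c Y d x y"
proof -
  obtain R e where R: "R \<subseteq> X \<times> Y" "(x, y) \<in> R" and e: "coalgebra R e"
    and e1: "coalgebra_hom R e X c fst" and e2: "coalgebra_hom R e Y d snd"
    using assms(3) by (auto simp: AM_bisimilar_def AM_bisimulation_def)
  define r where "r s t \<longleftrightarrow> (\<exists>(u, v)\<in>R. s = Inl u \<and> t = Inr v)" for s t :: "'x + 'y"
  \<comment> \<open>The predicate \<open>equivclp r s\<close> is the class of \<open>s\<close>, so
    \<open>q\<close> is the quotient map onto the pushout.\<close>
  define q where "q = equivclp r"
  define m1 where "m1 u = q (Inl u)" for u
  define m2 where "m2 v = q (Inr v)" for v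
  \<comment> \<open>\<open>F\<close> pushes one step of either coalgebra forward to the quotient. It
    agrees on related states because both steps are projections of \<open>e (u, v)\<close>.\<close>
  define F where "F s = (case s of Inl u \<Rightarrow> D_map m1 (c u) | Inr v \<Rightarrow> D_map m2 (d v))" for s
  have q_eq: "q s = q t \<longleftrightarrow> equivclp r s t" for s t
    using equivp_evquivclp[of r] unfolding q_def equivp_def by auto
  have m_eq: "m1 u = m2 v" if "(u, v) \<in> R" for u v
    using that unfolding m1_def m2_def q_eq by (intro r_into_equivclp) (auto simp: r_def)
  have F_r: "F s = F t" if rst: "r s t" for s t
  proof -
    obtain u v where uv: "(u, v) \<in> R" "s = Inl u" "t = Inr v"
      using rst by (auto simp: r_def)
    have D: "e (u, v) \<in> D_obj R"
      using e uv by (auto simp: coalgebra_def)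
    have "c u = D_map fst (e (u, v))" "d v = D_map snd (e (u, v))"
      using e1 e2 uv by (auto simp: coalgebra_hom_def)
    moreover have "D_map (m1 \<circ> fst) (e (u, v)) = D_map (m2 \<circ> snd) (e (u, v))"
      using D m_eq by (intro D_map_cong) auto
    ultimately show ?thesis
      using D uv by (simp add: F_def D_map_comp)
  qed
  have F_q: "F s = F t" if "q s = q t" for s t
    using that[unfolded q_eq] by (induction rule: equivclp_induct) (auto dest: F_r)
  \<comment> \<open>The choice of representative is harmless, since \<open>F\<close> is constant on
    classes.\<close>
  define e' where "e' z = F (SOME s. q s = z)" for z
  have e': "e' (q s) = F s" for s
    unfolding e'_def by (rule F_q, rule someI) (rule refl)
  define Z where "Z = m1 ` X \<union> m2 ` Y"
  have "coalgebra Z e'"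
    using X Y e' by (auto simp: coalgebra_def Z_def m1_def m2_def F_def
      intro!: D_map_in_D_obj)
  moreover have "coalgebra_hom X c Z e' m1" "coalgebra_hom Y d Z e' m2"
    using e' by (auto simp: coalgebra_hom_def Z_def F_def m1_def m2_def)
  ultimately have "cocongruence X c Y d Z m1 m2"
    by (auto simp: cocongruence_def)
  moreover have "(x, y) \<in> kernel_bisimulation X Y m1 m2"
    using R m_eq by (auto simp: kernel_bisimulation_def)
  \<comment> \<open>\<open>Z\<close> consists of predicates on the sum type;
    \<open>kernel_bisimilarI\<close> moves the cocongruence to the sum type itself.\<close>
  ultimately show ?thesis
    by (rule kernel_bisimilarI[OF X Y])
qed

section \<open>Decomposability from two-state coalgebras\<close>

text \<open>A constant map collapses a distribution to its total weight, so two-point distributions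
  with equal sums become indistinguishable.\<close>

lemma D_obj_pair:
  fixes a b :: "'e::effect_algebra"
  assumes "u \<noteq> v" "a \<oplus> b = Some s" "\<Gamma> = (\<lambda>_. 0)(u := a, v := b)"
  shows "\<Gamma> \<in> D_obj {u, v}" and "D_map (\<lambda>_. z) \<Gamma> = (\<lambda>_. 0)(z := s)"
proof -
  have sub: "supp \<Gamma> \<subseteq> {u, v}"
    using assms by (auto simp: supp_def)
  have sum: "esum \<Gamma> {u, v} = Some s"
    using assms by (simp add: esum_pair)
  then have "esum \<Gamma> (supp \<Gamma>) \<noteq> None"
    using esum_subset_defined[OF _ sub, of \<Gamma>] by simp
  then show "\<Gamma> \<in> D_obj {u, v}"
    using sub by (auto simp: D_obj_def intro: finite_subset)
  show "D_map (\<lambda>_. z) \<Gamma> = (\<lambda>_. 0)(z := s)"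
  proof (rule D_map_eqI[OF _ sub])
    show "esum \<Gamma> {p \<in> {u, v}. z = w} = Some (((\<lambda>_. 0)(z := s)) w)" for w
      using sum by (cases "z = w") (simp_all del: insert_iff)
  qed simp
qed

lemma decomposable_if_AM_bisimilar:
  assumes AM: "\<And>(X :: 'x::infinite set) (c :: 'x \<Rightarrow> 'x \<Rightarrow> 'e::effect_algebra)
      (Y :: 'y::infinite set) (d :: 'y \<Rightarrow> 'y \<Rightarrow> 'e) x y.
      coalgebra X c \<Longrightarrow> coalgebra Y d \<Longrightarrow> x \<in> X \<Longrightarrow> y \<in> Y \<Longrightarrow>
      kernel_bisimilar X c Y d x y \<Longrightarrow> AM_bisimilar X c Y d x y"
  shows "decomposable TYPE('e)"
  unfolding decomposable_def
proof (intro allI impI)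
  fix a b c d :: 'e
  assume *: "a \<oplus> b \<noteq> None \<and> c \<oplus> d \<noteq> None \<and> a \<oplus> b = c \<oplus> d"
  then obtain s where s: "a \<oplus> b = Some s" "c \<oplus> d = Some s"
    by auto
  obtain x1 x2 :: 'x where x: "x1 \<noteq> x2"
    using arb_element[of "{undefined :: 'x}"] by auto
  obtain y1 y2 :: 'y where y: "y1 \<noteq> y2"
    using arb_element[of "{undefined :: 'y}"] by auto
  define \<Gamma> where "\<Gamma> = (\<lambda>_. 0)(x1 := a, x2 := b)"
  define \<Theta> where "\<Theta> = (\<lambda>_. 0)(y1 := c, y2 := d)"
  note \<Gamma> = D_obj_pair[OF x s(1) \<Gamma>_def] and \<Theta> = D_obj_pair[OF y s(2) \<Theta>_def]
  define X where "X = {x1, x2}"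
  define Y where "Y = {y1, y2}"
  have X: "coalgebra X (\<lambda>_. \<Gamma>)" and Y: "coalgebra Y (\<lambda>_. \<Theta>)"
    using \<Gamma>(1) \<Theta>(1) by (auto simp: coalgebra_def X_def Y_def)
  have "D_map (\<lambda>_. ()) \<Gamma> \<in> D_obj {()}"
    by (rule D_map_in_D_obj[OF \<Gamma>(1)]) auto
  \<comment> \<open>Both coalgebras map to the one-state coalgebra whose loop has weight
    \<open>s\<close>, so all their states are kernel bisimilar.\<close>
  then have "cocongruence X (\<lambda>_. \<Gamma>) Y (\<lambda>_. \<Theta>) {()} (\<lambda>_. ()) (\<lambda>_. ())"
    unfolding cocongruence_def
    by (intro exI[of _ "\<lambda>_. D_map (\<lambda>_. ()) \<Gamma>"])
      (simp add: coalgebra_def coalgebra_hom_def \<Gamma>(2) \<Theta>(2))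
  then have "kernel_bisimilar X (\<lambda>_. \<Gamma>) Y (\<lambda>_. \<Theta>) x1 y1"
    by (rule kernel_bisimilarI[OF X Y]) (simp add: kernel_bisimulation_def X_def Y_def)
  then have "AM_bisimilar X (\<lambda>_. \<Gamma>) Y (\<lambda>_. \<Theta>) x1 y1"
    using X Y by (intro AM) (auto simp: X_def Y_def)
  then obtain R e where R: "R \<subseteq> X \<times> Y" "(x1, y1) \<in> R" and e: "coalgebra R e"
    and e1: "coalgebra_hom R e X (\<lambda>_. \<Gamma>) fst" and e2: "coalgebra_hom R e Y (\<lambda>_. \<Theta>) snd"
    by (auto simp: AM_bisimilar_def AM_bisimulation_def)
  define \<Delta> where "\<Delta> = e (x1, y1)"
  have D: "\<Delta> \<in> D_obj R"
    using e R by (auto simp: \<Delta>_def coalgebra_def)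
  have D1: "D_map fst \<Delta> = \<Gamma>" and D2: "D_map snd \<Delta> = \<Theta>"
    using e1 e2 R by (auto simp: \<Delta>_def coalgebra_hom_def)
  have sub: "supp \<Delta> \<subseteq> X \<times> Y"
    using D R by (auto simp: D_obj_def)
  \<comment> \<open>A pair outside the support contributes 0, so both pairs may be summed even if
    one is not in \<open>R\<close>.\<close>
  have row: "Some (\<Gamma> u) = \<Delta> (u, y1) \<oplus> \<Delta> (u, y2)" for u
  proof -
    have "esum \<Delta> {p \<in> supp \<Delta>. fst p = u} = esum \<Delta> {(u, y1), (u, y2)}"
      using sub by (intro esum_mono_neutral) (auto simp: Y_def supp_def)
    then show ?thesis
      using D_map_eq[OF D, of fst u] y by (simp add: D1 esum_pair)
  qed
  have col: "Some (\<Theta> v) = \<Delta> (x1, v) \<oplus> \<Delta> (x2, v)" for v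
  proof -
    have "esum \<Delta> {p \<in> supp \<Delta>. snd p = v} = esum \<Delta> {(x1, v), (x2, v)}"
      using sub by (intro esum_mono_neutral) (auto simp: X_def supp_def)
    then show ?thesis
      using D_map_eq[OF D, of snd v] x by (simp add: D2 esum_pair)
  qed
  \<comment> \<open>The entry in row i and column j is the weight under \<open>\<Delta>\<close> of
    the pair of the i-th state of \<open>X\<close> and the j-th state of \<open>Y\<close>.\<close>
  show "\<exists>e11 e12 e21 e22. Some a = e11 \<oplus> e12 \<and> Some b = e21 \<oplus> e22 \<and>
      Some c = e11 \<oplus> e21 \<and> Some d = e12 \<oplus> e22"
    using row[of x1] row[of x2] col[of y1] col[of y2] x y
    by (auto simp: \<Gamma>_def \<Theta>_def)
qed

theorem mainTheorem3:
  shows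
    "(\<forall>(X :: 'a set) (c :: 'a \<Rightarrow> 'a \<Rightarrow> 'e::effect_algebra) (Y :: 'b set) (d :: 'b \<Rightarrow> 'b \<Rightarrow> 'e).
        coalgebra X c \<and> coalgebra Y d \<longrightarrow>
        (\<forall>x\<in>X. \<forall>y\<in>Y. AM_bisimilar X c Y d x y \<longrightarrow> kernel_bisimilar X c Y d x y))
     \<and>
     ((\<forall>(X :: 'x::infinite set) (c :: 'x \<Rightarrow> 'x \<Rightarrow> 'e) (Y :: 'y::infinite set) (d :: 'y \<Rightarrow> 'y \<Rightarrow> 'e).
         coalgebra X c \<and> coalgebra Y d \<longrightarrow>
         (\<forall>x\<in>X. \<forall>y\<in>Y. kernel_bisimilar X c Y d x y \<longrightarrow> AM_bisimilar X c Y d x y))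
      \<longleftrightarrow> decomposable TYPE('e))"
proof (intro conjI iffI allI ballI impI)
  fix X :: "'a set" and c :: "'a \<Rightarrow> 'a \<Rightarrow> 'e" and Y :: "'b set" and d :: "'b \<Rightarrow> 'b \<Rightarrow> 'e" and x y
  assume "coalgebra X c \<and> coalgebra Y d" "AM_bisimilar X c Y d x y"
  then show "kernel_bisimilar X c Y d x y"
    by (auto intro: kernel_bisimilar_if_AM_bisimilar)
next
  assume *: "\<forall>(X :: 'x set) (c :: 'x \<Rightarrow> 'x \<Rightarrow> 'e) (Y :: 'y set) (d :: 'y \<Rightarrow> 'y \<Rightarrow> 'e).
    coalgebra X c \<and> coalgebra Y d \<longrightarrow>
    (\<forall>x\<in>X. \<forall>y\<in>Y. kernel_bisimilar X c Y d x y \<longrightarrow> AM_bisimilar X c Y d x y)"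
  show "decomposable TYPE('e)"
    by (rule decomposable_if_AM_bisimilar[where ?'x = 'x and ?'y = 'y]) (use * in auto)
next
  fix X :: "'x set" and c :: "'x \<Rightarrow> 'x \<Rightarrow> 'e" and Y :: "'y set" and d :: "'y \<Rightarrow> 'y \<Rightarrow> 'e" and x y
  assume "decomposable TYPE('e)" "coalgebra X c \<and> coalgebra Y d" "kernel_bisimilar X c Y d x y"
  then show "AM_bisimilar X c Y d x y"
    by (auto intro: AM_bisimilar_if_kernel_bisimilar)
qed

end
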